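(* No variable-length protocol in the adaptive feedback model with a binary alphabet that computes the identity function $f(x,y)=(x,y)$ (message exchange) is resilient to a $\frac13$ fraction of errors.
   Context: Adaptive feedback model: Alice holds $x\in\{0,1\}^n$, Bob holds $y\in\{0,1\}^n$. The protocol is deterministic. In each round a single party sends one symbol of an alphabet $\Sigma$ to the other party, and the sender learns what the other party actually received, so both parties share the transcript $T$ of received symbols. The speaker of each round is a function of $T$, and the (common) decision to terminate is a function of $T$. The adversary may corrupt any transmitted symbol. The protocol is resilient to an $\alpha$ fraction of errors if for all $x,y$ and all adversarial attacks in which the parties terminate at round $R$, if the number of corrupted rounds is at most $\alpha R$ then both parties output $f(x,y)$. Here $\Sigma=\{0,1\}$.
   Formalization: The input length n is assumed to be at least 2 (for n = 0 or 1 sending the inputs once is trivially resilient), and a variable-length protocol is required to terminate under every attack (a never-terminating protocol would be vacuously resilient). *)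

theory Defs
  imports Complex_Main
begin

datatype party = Alice | Bob

text \<open>
  A deterministic protocol with adaptive feedback. The argument of type \<open>'s list\<close> is always the
  shared transcript, i.e. the symbols received so far in chronological order. Who speaks and
  whether to stop depend on the transcript alone, whereas messages and outputs may also use the
  party's own input. By feedback a sender knows the received symbols as well, and what she sent
  herself is a function of her input and the transcript, so no further state is needed.
\<close>

record ('x, 'y, 's, 'o) protocol =
  speaker :: "'s list \<Rightarrow> party"
  stop :: "'s list \<Rightarrow> bool"
  msg_Alice :: "'x \<Rightarrow> 's list \<Rightarrow> 's"
  msg_Bob :: "'y \<Rightarrow> 's list \<Rightarrow> 's"
  out_Alice :: "'x \<Rightarrow> 's list \<Rightarrow> 'o"
  out_Bob :: "'y \<Rightarrow> 's list \<Rightarrow> 'o"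

definition sent :: "('x, 'y, 's, 'o) protocol \<Rightarrow> 'x \<Rightarrow> 'y \<Rightarrow> 's list \<Rightarrow> 's" where
  "sent P x y T = (case speaker P T of Alice \<Rightarrow> msg_Alice P x T | Bob \<Rightarrow> msg_Bob P y T)"

text \<open>
  An attack maps the current transcript and the symbol being sent to the symbol that is received.
  Attacks are quantified after the inputs, hence they may depend on both inputs and on the protocol.
\<close>

type_synonym 's attack = "'s list \<Rightarrow> 's \<Rightarrow> 's"

fun transcript :: "('x, 'y, 's, 'o) protocol \<Rightarrow> 's attack \<Rightarrow> 'x \<Rightarrow> 'y \<Rightarrow> nat \<Rightarrow> 's list" where
  "transcript P adv x y 0 = []"
| "transcript P adv x y (Suc r) =
     (let T = transcript P adv x y r in T @ [adv T (sent P x y T)])"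

definition corruptions :: "('x, 'y, 's, 'o) protocol \<Rightarrow> 's attack \<Rightarrow> 'x \<Rightarrow> 'y \<Rightarrow> nat \<Rightarrow> nat" where
  "corruptions P adv x y R =
     card {r. r < R \<and> (let T = transcript P adv x y r in adv T (sent P x y T) \<noteq> sent P x y T)}"

definition terminates_at :: "('x, 'y, 's, 'o) protocol \<Rightarrow> 's attack \<Rightarrow> 'x \<Rightarrow> 'y \<Rightarrow> nat \<Rightarrow> bool" where
  "terminates_at P adv x y R \<longleftrightarrow>
     stop P (transcript P adv x y R) \<and> (\<forall>r<R. \<not> stop P (transcript P adv x y r))"

text \<open>
  The number of rounds may depend on the attack, but it must be finite under every attack. Without
  this requirement a protocol that never stops would be resilient vacuously.
\<close>

definition variable_length :: "('x, 'y, 's, 'o) protocol \<Rightarrow> 'x set \<Rightarrow> 'y set \<Rightarrow> bool" where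
  "variable_length P X Y \<longleftrightarrow> (\<forall>x\<in>X. \<forall>y\<in>Y. \<forall>adv. \<exists>R. terminates_at P adv x y R)"

definition computes_resiliently ::
  "('x, 'y, 's, 'o) protocol \<Rightarrow> 'x set \<Rightarrow> 'y set \<Rightarrow> ('x \<Rightarrow> 'y \<Rightarrow> 'o) \<Rightarrow> real \<Rightarrow> bool" where
  "computes_resiliently P X Y f \<alpha> \<longleftrightarrow>
     (\<forall>x\<in>X. \<forall>y\<in>Y. \<forall>adv R.
        terminates_at P adv x y R \<longrightarrow> real (corruptions P adv x y R) \<le> \<alpha> * real R \<longrightarrow>
        out_Alice P x (transcript P adv x y R) = f x y \<and>
        out_Bob P y (transcript P adv x y R) = f x y)"

definition bitstrings :: "nat \<Rightarrow> bool list set" where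
  "bitstrings n = {x. length x = n}"

definition message_exchange :: "'x \<Rightarrow> 'y \<Rightarrow> 'x \<times> 'y" where
  "message_exchange x y = (x, y)"

end

theory Submission
  imports Defs
begin

text \<open>
  Fix three inputs for each party and let every received bit be the majority of the three bits
  that the speaker would send on these inputs. The transcript then does not depend on the inputs,
  and every round is corrupted for at most one of the speaker's three inputs. Let
  \<open>a\<^sub>1 \<le> a\<^sub>2 \<le> a\<^sub>3\<close> and \<open>b\<^sub>1 \<le> b\<^sub>2 \<le> b\<^sub>3\<close> be the numbers of corruptions charged to the inputs of
  Alice and of Bob. Their total is at most \<open>R\<close>, so that
  \<open>(a\<^sub>1 + b\<^sub>2) + (a\<^sub>2 + b\<^sub>1) \<le> 2 R / 3\<close>. If \<open>a\<^sub>1 + b\<^sub>2 \<le> R / 3\<close>, then Alice, on her first input,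
  cannot tell Bob's first two inputs apart; otherwise \<open>a\<^sub>2 + b\<^sub>1 \<le> R / 3\<close>, and the roles are
  exchanged.
\<close>

text \<open>Every element disagrees with exactly one of the two bits, so the two disagreement counts
  add up to 3 and cannot both exceed 1.\<close>

lemma majority_bit:
  fixes g :: "'a \<Rightarrow> bool"
  assumes "card X = 3"
  shows "\<exists>b. card {x \<in> X. g x \<noteq> b} \<le> 1"
proof -
  have "finite X"
    using assms by (simp add: card_ge_0_finite)
  have "card {x \<in> X. g x \<noteq> True} + card {x \<in> X. g x \<noteq> False} =
      card ({x \<in> X. g x \<noteq> True} \<union> {x \<in> X. g x \<noteq> False})"
    using \<open>finite X\<close> by (intro card_Un_disjoint [symmetric]) auto
  also have "{x \<in> X. g x \<noteq> True} \<union> {x \<in> X. g x \<noteq> False} = X"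
    by auto
  finally have "card {x \<in> X. g x \<noteq> True} \<le> 1 \<or> card {x \<in> X. g x \<noteq> False} \<le> 1"
    using assms by linarith
  then show ?thesis
    by blast
qed

lemma sorted_triple:
  fixes f :: "'a \<Rightarrow> 'b::linorder"
  assumes "card X = 3"
  obtains p q r where "X = {p, q, r}" "distinct [p, q, r]" "f p \<le> f q" "f q \<le> f r"
proof -
  have "finite X"
    using assms by (simp add: card_ge_0_finite)
  then obtain xs where xs: "set xs = X" "distinct xs"
    using finite_distinct_list by blast
  define ys where "ys = sort_key f xs"
  have ys: "set ys = X" "distinct ys" "sorted (map f ys)"
    using xs by (simp_all add: ys_def)
  then have "length ys = 3"
    using assms distinct_card by fastforce
  then obtain p q r where "ys = [p, q, r]"
    by (auto simp: numeral_3_eq_3 length_Suc_conv)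
  with ys show ?thesis
    by (intro that [of p q r]) auto
qed

text \<open>Double counting of pairs (input, round). In the application \<open>S\<close> selects the
  rounds of one speaker and \<open>E x r\<close> says that round \<open>r\<close> is corrupted when
  the speaker holds \<open>x\<close>.\<close>

lemma sum_card_rounds_le:
  fixes R :: nat
  assumes "finite X"
    and "\<And>r. r < R \<Longrightarrow> S r \<Longrightarrow> card {x \<in> X. E x r} \<le> 1"
  shows "(\<Sum>x\<in>X. card {r. r < R \<and> S r \<and> E x r}) \<le> card {r. r < R \<and> S r}"
proof -
  have "(\<Sum>x\<in>X. card {r. r < R \<and> S r \<and> E x r}) =
      (\<Sum>x\<in>X. card {r \<in> {r. r < R \<and> S r}. E x r})"
    by (simp add: conj_assoc)
  also have "\<dots> = (\<Sum>r | r < R \<and> S r. card {x \<in> X. E x r})"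
    using assms(1) by (intro sum_multicount_gen) auto
  also have "\<dots> \<le> (\<Sum>r | r < R \<and> S r. 1)"
    using assms(2) by (intro sum_mono) auto
  finally show ?thesis
    by simp
qed

text \<open>The attack ignores the symbol sent, which is the only place where the inputs could enter
  the transcript.\<close>

lemma transcript_oblivious:
  "transcript P (\<lambda>T s. M T) x y r = transcript P (\<lambda>T s. M T) x' y' r"
  by (induction r) (simp_all add: Let_def)

text \<open>Each round is charged to its speaker, whose message depends on her own input and the
  transcript \<open>W r\<close> only. This separates the count into a term in \<open>x\<close> and a
  term in \<open>y\<close>.\<close>

lemma corruptions_split:
  assumes "\<And>r. transcript P adv x y r = W r" and "\<And>T s. adv T s = M T"
  shows "corruptions P adv x y R =
    card {r. r < R \<and> speaker P (W r) = Alice \<and> msg_Alice P x (W r) \<noteq> M (W r)} +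
    card {r. r < R \<and> speaker P (W r) = Bob \<and> msg_Bob P y (W r) \<noteq> M (W r)}"
proof -
  have eq: "{r. r < R \<and> (let T = transcript P adv x y r in adv T (sent P x y T) \<noteq> sent P x y T)} =
      {r. r < R \<and> speaker P (W r) = Alice \<and> msg_Alice P x (W r) \<noteq> M (W r)} \<union>
      {r. r < R \<and> speaker P (W r) = Bob \<and> msg_Bob P y (W r) \<noteq> M (W r)}"
    (is "?C = ?A \<union> ?B")
  proof (rule set_eqI)
    show "r \<in> ?C \<longleftrightarrow> r \<in> ?A \<union> ?B" for r
      by (cases "speaker P (W r)") (auto simp: assms sent_def)
  qed
  show ?thesis
    unfolding corruptions_def eq by (rule card_Un_disjoint) auto
qed

lemma not_resilient_three_inputs:
  fixes P :: "('x, 'y, bool, 'x \<times> 'y) protocol"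
  assumes X: "card X = 3" and Y: "card Y = 3"
    and terminating: "variable_length P X Y"
    and resilient: "computes_resiliently P X Y message_exchange (1 / 3)"
  shows False
proof -
  have "\<forall>T. \<exists>b. case speaker P T of
      Alice \<Rightarrow> card {x \<in> X. msg_Alice P x T \<noteq> b} \<le> 1
    | Bob \<Rightarrow> card {y \<in> Y. msg_Bob P y T \<noteq> b} \<le> 1"
  proof
    show "\<exists>b. case speaker P T of
        Alice \<Rightarrow> card {x \<in> X. msg_Alice P x T \<noteq> b} \<le> 1
      | Bob \<Rightarrow> card {y \<in> Y. msg_Bob P y T \<noteq> b} \<le> 1" for T
      using majority_bit [OF X] majority_bit [OF Y] by (cases "speaker P T") simp_all
  qed
  from choice [OF this] obtain M where M: "case speaker P T of
      Alice \<Rightarrow> card {x \<in> X. msg_Alice P x T \<noteq> M T} \<le> 1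
    | Bob \<Rightarrow> card {y \<in> Y. msg_Bob P y T \<noteq> M T} \<le> 1" for T
    by blast
  define adv :: "bool attack" where "adv = (\<lambda>T s. M T)"
  have fin: "finite X" "finite Y"
    using X Y by (simp_all add: card_ge_0_finite)
  have "X \<noteq> {}" "Y \<noteq> {}"
    using X Y by auto
  then obtain x0 y0 where x0: "x0 \<in> X" and y0: "y0 \<in> Y"
    by blast
  define W where "W = transcript P adv x0 y0"
  have W: "transcript P adv x y r = W r" for x y r
    unfolding W_def adv_def by (rule transcript_oblivious)
  \<comment> \<open>Stopping is decided by the transcript, which is \<open>W\<close> for all inputs,
    so one \<open>R\<close> serves every pair.\<close>
  obtain R where "terminates_at P adv x0 y0 R"
    using terminating x0 y0 unfolding variable_length_def by blast
  then have ends: "terminates_at P adv x y R" for x y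
    by (simp add: terminates_at_def W)

  define a where
    "a x = card {r. r < R \<and> speaker P (W r) = Alice \<and> msg_Alice P x (W r) \<noteq> M (W r)}" for x
  define b where
    "b y = card {r. r < R \<and> speaker P (W r) = Bob \<and> msg_Bob P y (W r) \<noteq> M (W r)}" for y
  have corr: "corruptions P adv x y R = a x + b y" for x y
    unfolding a_def b_def by (rule corruptions_split [OF W]) (simp add: adv_def)

  have "sum a X + sum b Y \<le>
      card {r. r < R \<and> speaker P (W r) = Alice} + card {r. r < R \<and> speaker P (W r) = Bob}"
    unfolding a_def b_def
  proof (intro add_mono sum_card_rounds_le fin)
    show "card {x \<in> X. msg_Alice P x (W r) \<noteq> M (W r)} \<le> 1" if "speaker P (W r) = Alice" for r
      using M [of "W r"] that by simp
    show "card {y \<in> Y. msg_Bob P y (W r) \<noteq> M (W r)} \<le> 1" if "speaker P (W r) = Bob" for r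
      using M [of "W r"] that by simp
  qed
  also have "\<dots> = card ({r. r < R \<and> speaker P (W r) = Alice} \<union> {r. r < R \<and> speaker P (W r) = Bob})"
    by (rule card_Un_disjoint [symmetric]) auto
  also have "\<dots> \<le> card {..<R}"
    by (rule card_mono) auto
  finally have total: "sum a X + sum b Y \<le> R"
    by simp

  obtain x1 x2 x3 where x: "X = {x1, x2, x3}" "distinct [x1, x2, x3]" "a x1 \<le> a x2" "a x2 \<le> a x3"
    by (rule sorted_triple [OF X])
  obtain y1 y2 y3 where y: "Y = {y1, y2, y3}" "distinct [y1, y2, y3]" "b y1 \<le> b y2" "b y2 \<le> b y3"
    by (rule sorted_triple [OF Y])
  have out: "out_Alice P x (W R) = (x, y) \<and> out_Bob P y (W R) = (x, y)"
    if "x \<in> X" "y \<in> Y" "3 * (a x + b y) \<le> R" for x y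
  proof -
    have "real (corruptions P adv x y R) \<le> 1 / 3 * real R"
      using that(3) by (simp add: corr)
    with resilient that(1,2) ends
    have "out_Alice P x (transcript P adv x y R) = message_exchange x y \<and>
        out_Bob P y (transcript P adv x y R) = message_exchange x y"
      unfolding computes_resiliently_def by blast
    then show ?thesis
      by (simp add: W message_exchange_def)
  qed
  have "(a x1 + a x2 + a x3) + (b y1 + b y2 + b y3) \<le> R"
    using total x(1,2) y(1,2) by simp
  \<comment> \<open>Dropping the largest of three numbers leaves at most two thirds of their sum;
    this is applied to \<open>a\<close> and to \<open>b\<close>.\<close>
  with x(3,4) y(3,4) have "3 * (a x1 + b y2) + 3 * (a x2 + b y1) \<le> 2 * R"
    by simp
  then have "3 * (a x1 + b y2) \<le> R \<or> 3 * (a x2 + b y1) \<le> R"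
    by linarith
  then show False
  proof
    assume "3 * (a x1 + b y2) \<le> R"
    \<comment> \<open>As \<open>b y1 \<le> b y2\<close>, the pair \<open>(x1, y1)\<close> is within
      the budget as well.\<close>
    then have "out_Alice P x1 (W R) = (x1, y1)" "out_Alice P x1 (W R) = (x1, y2)"
      using out [of x1 y1] out [of x1 y2] x y by auto
    then show False
      using y(2) by simp
  next
    assume "3 * (a x2 + b y1) \<le> R"
    then have "out_Bob P y1 (W R) = (x1, y1)" "out_Bob P y1 (W R) = (x2, y1)"
      using out [of x1 y1] out [of x2 y1] x y by auto
    then show False
      using x(2) by simp
  qed
qed

text \<open>This is where \<open>n \<ge> 2\<close> enters: a single bit offers only two
  inputs.\<close>

lemma bitstrings_three:
  assumes "n \<ge> 2"
  obtains X where "X \<subseteq> bitstrings n" "card X = 3"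
proof -
  have "(2::nat) ^ 2 \<le> 2 ^ n"
    using assms by (intro power_increasing) auto
  moreover have "card (bitstrings n) = 2 ^ n"
    using card_lists_length_eq [of "UNIV :: bool set" n] by (simp add: bitstrings_def)
  ultimately have "3 \<le> card (bitstrings n)"
    by simp
  then show ?thesis
    by (meson obtain_subset_with_card_n that)
qed

theorem theorem1p5:
  fixes n :: nat
  assumes "n \<ge> 2"
  shows "\<not> (\<exists>P :: (bool list, bool list, bool, bool list \<times> bool list) protocol.
             variable_length P (bitstrings n) (bitstrings n) \<and>
             computes_resiliently P (bitstrings n) (bitstrings n) message_exchange (1 / 3))"
proof
  assume "\<exists>P :: (bool list, bool list, bool, bool list \<times> bool list) protocol.
      variable_length P (bitstrings n) (bitstrings n) \<and>
      computes_resiliently P (bitstrings n) (bitstrings n) message_exchange (1 / 3)"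
  then obtain P :: "(bool list, bool list, bool, bool list \<times> bool list) protocol"
    where P: "variable_length P (bitstrings n) (bitstrings n)"
      "computes_resiliently P (bitstrings n) (bitstrings n) message_exchange (1 / 3)"
    by blast
  obtain X where X: "X \<subseteq> bitstrings n" "card X = 3"
    using bitstrings_three [OF assms] .
  \<comment> \<open>Both properties quantify universally over the inputs, so they pass to
    subsets.\<close>
  have "variable_length P X X"
    using P(1) X(1) unfolding variable_length_def by blast
  moreover have "computes_resiliently P X X message_exchange (1 / 3)"
    using P(2) X(1) unfolding computes_resiliently_def by blast
  ultimately show False
    using not_resilient_three_inputs X(2) by blast
qed

end
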